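(* Let $f:\mathbb{R}\to\mathbb{R}$ be measurable and let $0<s<\sigma<t<1$. Suppose there exists $C>0$ such that, for all bounded open intervals $I\subset\mathbb{R}$, we have $$M_t(f,I^-)-M_s(f,I^+)\le C.$$ Then there exist $K,\alpha>0$, depending only on $\sigma$ and $t$, such that, for all bounded open intervals $I\subset\mathbb{R}$ and all $\lambda>0$, we have $$|\{x\in I^l: f(x)-M_\sigma(f,I^r)>\lambda\}|\le K|I^l|\exp(-\alpha\lambda/C).$$
   Context: Lebesgue measure on $\mathbb{R}$ is denoted $|\cdot|$. For a bounded open interval $I=(a,b)$, $a<b$: $I^-=(a,\frac{a+b}{2})$ and $I^+=(\frac{a+b}{2},b)$ are its halves, and $I^l=(a,\frac{2a+b}{3})$, $I^r=(\frac{a+2b}{3},b)$ are its left and right thirds. Maximal median: for an interval $I$, a measurable $f:I\to\mathbb{R}$ and $0<s<1$, $M_s(f,I)=\sup\{\lambda\in\mathbb{R}:|\{x\in I:f(x)<\lambda\}|\le s|I|\}$. "Depending only on $\sigma$ and $t$" means that $K,\alpha$ can be chosen as functions of $\sigma,t$ alone, independently of $f$, $s$ and $C$. *)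

theory Defs
  imports "HOL-Analysis.Analysis"
begin

(* For 0 < s < 1, a bounded nonempty open interval I and f measurable on I, the set below
   is nonempty and bounded above, so Sup is the genuine supremum. *)
definition max_median :: "real \<Rightarrow> (real \<Rightarrow> real) \<Rightarrow> real set \<Rightarrow> real" where
  "max_median s f I =
     Sup {l. measure lebesgue {x \<in> I. f x < l} \<le> s * measure lebesgue I}"

(* Parts of the interval I = {a<..<b}, in terms of its endpoints. *)

definition left_half :: "real \<Rightarrow> real \<Rightarrow> real set" where
  "left_half a b = {a<..<(a + b) / 2}"

definition right_half :: "real \<Rightarrow> real \<Rightarrow> real set" where
  "right_half a b = {(a + b) / 2<..<b}"

definition left_third :: "real \<Rightarrow> real \<Rightarrow> real set" where
  "left_third a b = {a<..<(2 * a + b) / 3}"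

definition right_third :: "real \<Rightarrow> real \<Rightarrow> real set" where
  "right_third a b = {(a + 2 * b) / 3<..<b}"

end

theory Submission
  imports Defs
begin

text \<open>
  The hypothesis is a statement about superlevel sets. Put $\tau = 1 - t$ and
  $\rho = 1 - \sigma$, so that $\tau < \rho$. If $\{f > m\}$ fills less than the fraction
  $\rho$ of an interval, then the median $M_s(f,\cdot)$ of that interval is at most $m$, hence the median
  $M_t(f,\cdot)$ of the adjacent interval of the same length to the left is below $m + 2C$, and
  $\{f > m + 2C\}$ fills at most the fraction $\tau$ of it
  (\<open>median_transfer\<close>). Only this transfer principle for the sets
  $E_k = \{f > m + 2Ck\}$ is used afterwards; it is the content of the locale
  \<open>one_sided_levels\<close>.

  Fix a density $r$ with $\tau < r < \rho$, and call a point $b$ sparse for $E$ at scale $h$ if $E$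
  has density at most $r$ in $(b,y)$ for all $b < y \le b + h$. The transfer then gives
  $|E_{k+1} \cap (b-h,b)| \le \tau h$. A one-sided rising sun decomposition of $(b-h,b)$ with
  respect to $E_{k+1}$ and the density $r$ covers almost all of $E_{k+1}$ by disjoint intervals
  $(u,v)$ in which $E_{k+1}$ has density at least $r$; their total length is thus at most
  $(\tau/r) h$. Each right endpoint $v$ is sparse for $E_{k+1}$ at scale $v-u$, also when
  the scale reaches beyond $b$: there the sparseness of $b$ itself takes over. So the situation
  at $b$ is reproduced at every $v$, and iterating yields
  $|E_{j+k} \cap (b-h,b)| \le (\tau/r)^k h$ (\<open>decay\<close>). This is the John-Nirenberg
  mechanism, with the gap between $\tau$ and $\rho$ as its only source of decay.

  It remains to cross the middle third. By the transfer from the right third, the middle third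
  contains a sparse point at a scale comparable to the length of the thirds. A sparse point for
  $E_k$ produces one for $E_{k+1}$, at the same scale and a definite
  distance further left (\<open>sparse_point_shift\<close>), so a number of shifts which depends on
  $\tau/r$ alone reaches the left end of the left third. Adding up the decay estimates to the left
  of these points gives geometric decay of $|E_{n+k}|$ on the left third
  (\<open>decay_across_gap\<close>), and the exponential estimate is its interpolation in $\lambda$.
\<close>

section \<open>Open subsets of the line and their component intervals\<close>

lemma bounded_open_component_interval:
  fixes V :: "real set"
  assumes "open V" "bounded V" "W \<in> components V"
  obtains u v where "u < v" "W = {u<..<v}" "u \<notin> V" "v \<notin> V"
proof -
  have op: "open W" and conn: "connected W" and ne: "W \<noteq> {}" and sub: "W \<subseteq> V"
    using assms open_components in_components_connected in_components_nonempty
      in_components_subset by blast+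
  have bdd: "bdd_above W" "bdd_below W"
    using bounded_subset[OF assms(2) sub] by (simp_all add: bounded_imp_bdd_above bounded_imp_bdd_below)
  define u v where "u = Inf W" and "v = Sup W"
  have bounds: "u < x \<and> x < v" if x: "x \<in> W" for x
  proof -
    obtain e where "e > 0" "ball x e \<subseteq> W"
      using openE[OF op x] .
    moreover have "x - e/2 \<in> ball x e" "x + e/2 \<in> ball x e"
      using \<open>e > 0\<close> by (simp_all add: dist_real_def)
    ultimately have "x - e/2 \<in> W" "x + e/2 \<in> W" by blast+
    then have "u \<le> x - e/2" "x + e/2 \<le> v"
      unfolding u_def v_def by (blast intro: cInf_lower[OF _ bdd(2)] cSup_upper[OF _ bdd(1)])+
    with \<open>e > 0\<close> show ?thesis by auto
  qed
  have eq: "W = {u<..<v}"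
  proof
    show "W \<subseteq> {u<..<v}" using bounds by auto
    show "{u<..<v} \<subseteq> W"
    proof
      fix x assume x: "x \<in> {u<..<v}"
      then obtain y z where "y \<in> W" "y < x" "z \<in> W" "x < z"
        using ne bdd by (auto simp: u_def v_def cInf_less_iff less_cSup_iff)
      then show "x \<in> W"
        using conn by (meson connected_contains_Icc atLeastAtMost_iff less_imp_le subsetD)
    qed
  qed
  have uv: "u < v" using ne bounds by force
  have "u \<notin> V"
  proof
    assume "u \<in> V"
    then have "{u..<v} \<subseteq> V" using sub eq uv by (auto simp: subset_iff le_less)
    moreover have "W \<inter> {u..<v} = W" using eq by auto
    ultimately have "{u..<v} \<subseteq> W"
      using components_maximal[OF assms(3) connected_Ico] ne by auto
    then show False using eq uv by auto
  qed
  moreover have "v \<notin> V"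
  proof
    assume "v \<in> V"
    then have "{u<..v} \<subseteq> V" using sub eq uv by (auto simp: subset_iff le_less)
    moreover have "W \<inter> {u<..v} = W" using eq by auto
    ultimately have "{u<..v} \<subseteq> W"
      using components_maximal[OF assms(3) connected_Ioc] ne by auto
    then show False using eq uv by auto
  qed
  ultimately show thesis using that uv eq by blast
qed

text \<open>
  The components of an open set are countably many disjoint intervals, so an inequality between
  measures on each of them adds up. This allows comparisons on one maximal interval at a time.
\<close>

lemma measure_le_by_components:
  fixes V S T :: "real set"
  assumes V: "open V" "bounded V" and S: "S \<in> sets lebesgue" and T: "T \<in> sets lebesgue"
    and "c \<ge> 0"
    and le: "\<And>u v. u < v \<Longrightarrow> {u<..<v} \<subseteq> V \<Longrightarrow> u \<notin> V \<Longrightarrow> v \<notin> V \<Longrightarrow>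
       measure lebesgue (S \<inter> {u<..<v}) \<le> c * measure lebesgue (T \<inter> {u<..<v})"
  shows "measure lebesgue (S \<inter> V) \<le> c * measure lebesgue (T \<inter> V)"
proof -
  let ?C = "components V"
  have opC: "open W" if "W \<in> ?C" for W using that V(1) open_components by blast
  have count: "countable ?C"
    using opC by (intro countable_disjoint_open_subsets) (auto simp: disjoint_def components_nonoverlap)
  have meas: "X \<inter> W \<in> lmeasurable" if "X \<in> sets lebesgue" "bounded W" "open W" for X W :: "real set"
    using that by (simp add: bounded_set_imp_lmeasurable sets.Int bounded_Int)
  have split: "emeasure lebesgue (X \<inter> V) = (\<integral>\<^sup>+W. emeasure lebesgue (X \<inter> W) \<partial>count_space ?C)"
    if X: "X \<in> sets lebesgue" for X
  proof -
    have "X \<inter> V = (\<Union>W\<in>?C. X \<inter> W)" using Union_components[of V] by auto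
    moreover have "emeasure lebesgue (\<Union>W\<in>?C. X \<inter> W) = (\<integral>\<^sup>+W. emeasure lebesgue (X \<inter> W) \<partial>count_space ?C)"
    proof (rule emeasure_UN_countable[OF _ count])
      show "X \<inter> W \<in> sets lebesgue" if "W \<in> ?C" for W
        using X opC[OF that] by (intro sets.Int) auto
      show "disjoint_family_on ((\<inter>) X) ?C"
        using pairwise_disjoint_components[of V] by (auto simp: disjoint_family_on_def pairwise_def disjnt_def)
    qed
    ultimately show ?thesis by simp
  qed
  have one: "emeasure lebesgue (S \<inter> W) \<le> ennreal c * emeasure lebesgue (T \<inter> W)" if W: "W \<in> ?C" for W
  proof -
    obtain u v where uv: "u < v" "W = {u<..<v}" "u \<notin> V" "v \<notin> V"
      using bounded_open_component_interval[OF V W] .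
    have "W \<subseteq> V" using W in_components_subset by blast
    then have "measure lebesgue (S \<inter> W) \<le> c * measure lebesgue (T \<inter> W)"
      using le uv by simp
    moreover have "S \<inter> W \<in> lmeasurable" "T \<inter> W \<in> lmeasurable"
      using meas[OF S] meas[OF T] uv(2) by auto
    ultimately show ?thesis
      using \<open>c \<ge> 0\<close> by (simp add: emeasure_eq_measure2 flip: ennreal_mult')
  qed
  have "emeasure lebesgue (S \<inter> V) \<le> (\<integral>\<^sup>+W. ennreal c * emeasure lebesgue (T \<inter> W) \<partial>count_space ?C)"
    unfolding split[OF S] by (rule nn_integral_mono) (use one in auto)
  also have "\<dots> = ennreal c * emeasure lebesgue (T \<inter> V)"
    unfolding split[OF T] by (rule nn_integral_cmult) auto
  finally show ?thesis
    using meas[OF S V(2,1)] meas[OF T V(2,1)] \<open>c \<ge> 0\<close>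
    by (simp add: emeasure_eq_measure2 flip: ennreal_mult')
qed

section \<open>The portion of a set in an interval\<close>

definition amount :: "real set \<Rightarrow> real \<Rightarrow> real \<Rightarrow> real" where
  "amount E x y = measure lebesgue (E \<inter> {x<..<y})"

lemma amount_lmeasurable: "E \<in> sets lebesgue \<Longrightarrow> E \<inter> {x<..<y::real} \<in> lmeasurable"
  by (simp add: bounded_set_imp_lmeasurable sets.Int bounded_Int)

lemma amount_nonneg: "0 \<le> amount E x y"
  by (simp add: amount_def)

lemma amount_mono:
  assumes "E \<in> sets lebesgue" "F \<in> sets lebesgue" "E \<subseteq> F" "x' \<le> x" "y \<le> y'"
  shows "amount E x y \<le> amount F x' y'"
  unfolding amount_def
  by (rule measure_mono_fmeasurable) (use assms amount_lmeasurable in \<open>auto simp: sets.Int\<close>)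

lemma amount_le_length:
  assumes "E \<in> sets lebesgue" "x \<le> y"
  shows "amount E x y \<le> y - x"
  using amount_mono[of E UNIV x x y y] assms by (simp add: amount_def)

lemma amount_split:
  assumes E: "E \<in> sets lebesgue" and "x \<le> y" "y \<le> z"
  shows "amount E x z = amount E x y + amount E y z"
proof -
  let ?A = "E \<inter> {x<..<y}" and ?B = "E \<inter> {y<..<z}"
  have "measure lebesgue (?A \<union> ?B) = measure lebesgue ?A + measure lebesgue ?B"
    using amount_lmeasurable[OF E] by (intro measure_Un_AE) (auto simp: fmeasurableD)
  moreover have "measure lebesgue (E \<inter> {x<..<z}) = measure lebesgue (?A \<union> ?B)"
  proof (rule measure_negligible_symdiff)
    show "?A \<union> ?B \<in> lmeasurable" using amount_lmeasurable[OF E] by (intro fmeasurable.Un)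
    have "(?A \<union> ?B) - E \<inter> {x<..<z} \<union> (E \<inter> {x<..<z} - (?A \<union> ?B)) \<subseteq> {y}"
      using assms(2,3) by auto
    then show "negligible ((?A \<union> ?B) - E \<inter> {x<..<z} \<union> (E \<inter> {x<..<z} - (?A \<union> ?B)))"
      by (rule negligible_subset[OF negligible_sing])
  qed
  ultimately show ?thesis by (simp add: amount_def)
qed

lemma continuous_on_amount:
  assumes E: "E \<in> sets lebesgue"
  shows "continuous_on X (amount E a)"
proof (rule continuous_on_subset[OF _ subset_UNIV], rule lipschitz_on_continuous_on)
  have *: "\<bar>amount E a y - amount E a x\<bar> \<le> y - x" if "x \<le> y" for x y
  proof (cases "a \<le> x")
    case True
    then show ?thesis
      using amount_split[OF E True that] amount_le_length[OF E that] amount_nonneg[of E x y] by simp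
  next
    case False
    then have "amount E a x = 0" by (simp add: amount_def)
    then show ?thesis
      using amount_le_length[OF E, of a y] amount_nonneg[of E a y] False that
      by (cases "a \<le> y") (auto simp: amount_def)
  qed
  show "1-lipschitz_on UNIV (amount E a)"
  proof (rule lipschitz_onI)
    fix x y show "dist (amount E a x) (amount E a y) \<le> 1 * dist x y"
      using *[of x y] *[of y x] by (cases "x \<le> y") (auto simp: dist_real_def)
  qed simp
qed

section \<open>A one-sided rising sun decomposition\<close>

text \<open>
  A substitute for the density theorem, strong enough for sets that are sparse to the right of
  each of their own points. In an open interval $(u,v)$, all of $S$ except for a part of arbitrarily
  small measure lies to the right of a single point of $S$ close to the infimum of $S \cap (u,v)$, so
  $S$ fills at most the fraction $r$ of $(u,v)$. Hence
  $|S| \le r |V|$ for every open $V \supseteq S$, and the choice of $V$ with $|V|$ close to $|S|$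
  forces $|S| = 0$.
\<close>

lemma right_sparse_negligible:
  assumes S: "S \<in> sets lebesgue" "bounded S" and r: "0 \<le> r" "r < 1"
    and sparse: "\<And>x y. x \<in> S \<Longrightarrow> x < y \<Longrightarrow> amount S x y \<le> r * (y - x)"
  shows "measure lebesgue S = 0"
proof -
  have Sl: "S \<in> lmeasurable" by (rule bounded_set_imp_lmeasurable[OF S(2,1)])
  obtain R where R: "S \<subseteq> ball 0 R" using \<open>bounded S\<close> bounded_subset_ballD by blast
  have gap: "amount S u v \<le> r * (v - u)" if "u < v" for u v
  proof (cases "S \<inter> {u<..<v} = {}")
    case True
    then show ?thesis using r that by (simp add: amount_def)
  next
    case False
    define z where "z = Inf (S \<inter> {u<..<v})"
    have bdd: "bdd_below (S \<inter> {u<..<v})" by (rule bdd_belowI[of _ u]) auto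
    have "u \<le> z" unfolding z_def using False by (intro cInf_greatest) auto
    show ?thesis
    proof (rule field_le_epsilon)
      fix e :: real assume "e > 0"
      then obtain x where x: "x \<in> S" "u < x" "x < v" "x < z + e"
        using False bdd cInf_less_iff[of "S \<inter> {u<..<v}" "z + e"] by (auto simp: z_def)
      then have zx: "z \<le> x" using bdd by (auto simp: z_def intro: cInf_lower)
      have "S \<inter> {u<..<z} = {}"
        using cInf_lower[OF _ bdd] x(3) zx by (force simp: z_def[symmetric])
      then have "amount S u z = 0" by (simp add: amount_def)
      moreover have "amount S u x = amount S u z + amount S z x"
        by (rule amount_split) (use S \<open>u \<le> z\<close> zx in auto)
      moreover have "amount S z x \<le> x - z" by (rule amount_le_length) (use S zx in auto)
      moreover have "amount S x v \<le> r * (v - x)" using sparse[of x v] x by simp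
      moreover have "r * (v - x) \<le> r * (v - u)" using r x by (intro mult_left_mono) auto
      moreover have "amount S u v = amount S u x + amount S x v"
        by (rule amount_split) (use S x in auto)
      ultimately show "amount S u v \<le> r * (v - u) + e" using x by simp
    qed
  qed
  have "(1 - r) * measure lebesgue S \<le> 0"
  proof (rule field_le_epsilon)
    fix e :: real assume "e > 0"
    then obtain T where T: "open T" "S \<subseteq> T" "T - S \<in> lmeasurable" "emeasure lebesgue (T - S) < ennreal e"
      using sets_lebesgue_outer_open[OF S(1)] by metis
    define V where "V = T \<inter> ball 0 R"
    have V: "open V" "bounded V" "S \<subseteq> V" using T R by (auto simp: V_def bounded_Int)
    have Vl: "V \<in> lmeasurable" using V by (intro bounded_set_imp_lmeasurable) auto
    have "measure lebesgue (T - S) < e"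
      using T(3,4) by (simp add: emeasure_eq_measure2 ennreal_less_iff)
    moreover have "measure lebesgue (V - S) \<le> measure lebesgue (T - S)"
      by (rule measure_mono_fmeasurable) (use T(3) Vl Sl in \<open>auto simp: V_def\<close>)
    moreover have "measure lebesgue V = measure lebesgue S + measure lebesgue (V - S)"
      using measure_Un2[OF Sl Vl] V(3) by (simp add: Un_absorb1)
    moreover have "measure lebesgue (S \<inter> V) \<le> r * measure lebesgue (UNIV \<inter> V)"
      by (rule measure_le_by_components[OF V(1,2) S(1)])
         (use r gap in \<open>auto simp: amount_def\<close>)
    moreover have "S \<inter> V = S" using V by auto
    ultimately have "measure lebesgue S \<le> r * (measure lebesgue S + measure lebesgue (V - S))"
        and "measure lebesgue (V - S) \<le> e"
      by auto
    moreover have "r * measure lebesgue (V - S) \<le> 1 * measure lebesgue (V - S)"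
      using r by (intro mult_right_mono) auto
    ultimately show "(1 - r) * measure lebesgue S \<le> 0 + e" by (simp add: algebra_simps)
  qed
  then have "measure lebesgue S \<le> 0" using r by (simp add: mult_le_0_iff)
  then show ?thesis using measure_nonneg[of lebesgue S] by linarith
qed

text \<open>
  The maximum point $y$ of $w \mapsto |E \cap (x,w)| - r (w - x)$ on $[x,z]$ separates a part
  where $E$ is dense, ending at $y$, from a part where $E$ is sparse, starting at $y$.
\<close>

lemma last_peak:
  assumes E: "E \<in> sets lebesgue" and "x \<le> z"
  obtains y where "x \<le> y" "y \<le> z" "r * (y - x) \<le> amount E x y"
    "\<And>w. y < w \<Longrightarrow> w \<le> z \<Longrightarrow> amount E y w \<le> r * (w - y)"
proof -
  define g where "g = (\<lambda>w. amount E x w - r * (w - x))"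
  have "continuous_on {x..z} g"
    unfolding g_def by (intro continuous_intros continuous_on_amount E)
  then obtain y where y: "y \<in> {x..z}" "\<And>w. w \<in> {x..z} \<Longrightarrow> g w \<le> g y"
    using continuous_attains_sup[of "{x..z}" g] \<open>x \<le> z\<close> by force
  show thesis
  proof
    show "x \<le> y" "y \<le> z" using y(1) by auto
    show "r * (y - x) \<le> amount E x y"
      using y(2)[of x] \<open>x \<le> z\<close> by (simp add: g_def amount_def)
    show "amount E y w \<le> r * (w - y)" if "y < w" "w \<le> z" for w
      using y(2)[of w] y(1) that amount_split[OF E, of x y w] by (simp add: g_def algebra_simps)
  qed
qed

definition right_sparse :: "real \<Rightarrow> real set \<Rightarrow> real \<Rightarrow> real \<Rightarrow> bool" where
  "right_sparse r E b h \<longleftrightarrow> (\<forall>y. b < y \<and> y \<le> b + h \<longrightarrow> amount E b y \<le> r * (y - b))"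

lemma right_sparse_mono:
  assumes "right_sparse r E b h" "h' \<le> h" "F \<subseteq> E" "E \<in> sets lebesgue" "F \<in> sets lebesgue"
  shows "right_sparse r F b h'"
  unfolding right_sparse_def
proof (intro allI impI, elim conjE)
  fix y assume "b < y" "y \<le> b + h'"
  then have "amount E b y \<le> r * (y - b)" using assms by (auto simp: right_sparse_def)
  then show "amount F b y \<le> r * (y - b)"
    using amount_mono[of F E b b y y] assms by linarith
qed

lemma right_sparse_extend:
  assumes E: "E \<in> sets lebesgue"
    and near: "\<And>y. x < y \<Longrightarrow> y \<le> b \<Longrightarrow> amount E x y \<le> r * (y - x)"
    and far: "right_sparse r E b h" and "x \<le> b"
  shows "right_sparse r E x (b + h - x)"
  unfolding right_sparse_def
proof (intro allI impI, elim conjE)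
  fix y assume y: "x < y" "y \<le> x + (b + h - x)"
  show "amount E x y \<le> r * (y - x)"
  proof (cases "y \<le> b")
    case False
    have "amount E x b \<le> r * (b - x)"
      using near[of b] \<open>x \<le> b\<close> by (cases "x = b") (auto simp: amount_def)
    moreover have "amount E b y \<le> r * (y - b)"
      using far y False by (auto simp: right_sparse_def)
    ultimately show ?thesis
      using amount_split[OF E, of x b y] \<open>x \<le> b\<close> False by (simp add: algebra_simps)
  qed (use near y in auto)
qed

text \<open>
  The set $V$ consists of the points $x$ of $(b-h,b)$ for which $E$ has density greater than $r$ in
  some $(x,y)$ with $y \le b$. Off $V$ the set $E$ is sparse to the right, hence null. For a component
  $(u,v)$ the point $v$ is sparse, being either $b$ or a point of $(b-h,b)$ outside $V$. If
  $E$ had density less than $r$ in $(x,v)$ for some $u < x < v$, the last peak after $x$ would lie in $V$,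
  and the dense interval that witnesses this would have to end beyond $v$, against the sparseness
  of $v$.
\<close>

lemma rising_sun:
  assumes E: "E \<in> sets lebesgue" and r: "0 \<le> r" "r < 1"
    and b: "right_sparse r E b h"
  obtains V where "open V" "V \<subseteq> {b - h<..<b}" "measure lebesgue (E \<inter> {b - h<..<b} - V) = 0"
    "\<And>u v. u < v \<Longrightarrow> {u<..<v} \<subseteq> V \<Longrightarrow> u \<notin> V \<Longrightarrow> v \<notin> V \<Longrightarrow>
       right_sparse r E v (v - u) \<and> r * (v - u) \<le> amount E u v"
proof -
  let ?W = "amount E (b - h)"
  define V where "V = (\<Union>y\<in>{b - h<..b}. {b - h<..<y} \<inter> {x. r * (y - x) < ?W y - ?W x})"
  have V_iff: "x \<in> V \<longleftrightarrow> b - h < x \<and> (\<exists>y. x < y \<and> y \<le> b \<and> r * (y - x) < amount E x y)" for x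
  proof -
    have "?W y - ?W x = amount E x y" if "b - h < x" "x < y" for y
      using amount_split[OF E, of "b - h" x y] that by simp
    then show ?thesis unfolding V_def by force
  qed
  have "open V"
    unfolding V_def
    by (intro open_UN ballI open_Int open_greaterThanLessThan open_Collect_less continuous_intros
        continuous_on_amount E)
  moreover have V_sub: "V \<subseteq> {b - h<..<b}" unfolding V_def by auto
  moreover have "measure lebesgue (E \<inter> ({b - h<..<b} - V)) = 0"
  proof (rule right_sparse_negligible[OF _ _ r])
    fix x y assume x: "x \<in> E \<inter> ({b - h<..<b} - V)" and "x < y"
    \<comment> \<open>Sparseness off $V$ is known up to $b$ only, but there is nothing of the set beyond $b$.\<close>
    let ?F = "E \<inter> ({b - h<..<b} - V)"
    have F: "?F \<in> sets lebesgue" using E \<open>open V\<close> by auto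
    define z where "z = min y b"
    have z: "x < z" "z \<le> b" "z \<le> y" using x \<open>x < y\<close> by (auto simp: z_def)
    have "amount ?F x y = amount ?F x z"
      unfolding amount_def z_def by (rule arg_cong[where f = "measure lebesgue"]) auto
    also have "\<dots> \<le> amount E x z" by (rule amount_mono) (use E F in auto)
    also have "\<dots> \<le> r * (z - x)" using x z V_iff[of x] by force
    also have "\<dots> \<le> r * (y - x)" using r z by (intro mult_left_mono) auto
    finally show "amount ?F x y \<le> r * (y - x)" .
  qed (use \<open>open V\<close> E bounded_subset[of "{b - h<..<b}"] in auto)
  moreover have "right_sparse r E v (v - u) \<and> r * (v - u) \<le> amount E u v"
    if uv: "u < v" "{u<..<v} \<subseteq> V" "u \<notin> V" "v \<notin> V" for u v
  proof
    have uv_bounds: "b - h \<le> u" "v \<le> b"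
      using V_sub uv(1,2) greaterThanLessThan_subseteq_greaterThanLessThan[of u v "b - h" b] by auto
    have near: "amount E v y \<le> r * (y - v)" if "v < y" "y \<le> b" for y
      using V_iff[of v] uv that uv_bounds by force
    have "right_sparse r E v (b + h - v)"
      by (rule right_sparse_extend[OF E near b]) (use uv_bounds in auto)
    then show "right_sparse r E v (v - u)"
      by (rule right_sparse_mono) (use uv_bounds E uv in auto)
    have from_inside: "r * (v - x) \<le> amount E u v" if x: "u < x" "x < v" for x
    proof -
      obtain y where y: "x \<le> y" "y \<le> v" "r * (y - x) \<le> amount E x y"
        "\<And>w. y < w \<Longrightarrow> w \<le> v \<Longrightarrow> amount E y w \<le> r * (w - y)"
        using last_peak[OF E, of x v r] x by auto
      have "y = v"
      proof (rule ccontr)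
        assume "y \<noteq> v"
        then have "y \<in> V" using y x uv(2) by auto
        then obtain w where w: "y < w" "w \<le> b" "r * (w - y) < amount E y w"
          using V_iff by blast
        have "v < w" using y(4)[of w] w by force
        then show False
          using near[of w] y(4)[of v] w \<open>y \<noteq> v\<close> y(2) amount_split[OF E, of y v w]
          by (simp add: algebra_simps)
      qed
      then show ?thesis using y(3) amount_mono[OF E E, of u x v v] x by simp
    qed
    show "r * (v - u) \<le> amount E u v"
    proof (rule field_le_epsilon)
      fix e :: real assume "e > 0"
      define x where "x = u + min e ((v - u) / 2)"
      have x: "u < x" "x < v" "x - u \<le> e" using uv(1) \<open>e > 0\<close> by (auto simp: x_def min_def field_simps)
      have "r * (x - u) \<le> 1 * (x - u)" using r x by (intro mult_right_mono) auto
      then show "r * (v - u) \<le> amount E u v + e"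
        using from_inside[OF x(1,2)] x(3) by (simp add: algebra_simps)
    qed
  qed
  ultimately show thesis using that[of V] by (simp add: Int_Diff)
qed


section \<open>Geometric decay of the levels\<close>

text \<open>
  The sets $E_k$ stand for equally spaced superlevel sets; \<open>transfer\<close> is all that the
  median condition says about them.
\<close>

locale one_sided_levels =
  fixes E :: "nat \<Rightarrow> real set" and \<rho> r \<tau> :: real
  assumes meas: "E k \<in> sets lebesgue"
    and decreasing: "E (Suc k) \<subseteq> E k"
    and params: "0 < \<tau>" "\<tau> < r" "r < \<rho>" "\<rho> < 1"
    and transfer: "0 < h \<Longrightarrow> amount (E k) b (b + h) < \<rho> * h \<Longrightarrow> amount (E (Suc k)) (b - h) b \<le> \<tau> * h"
begin

lemma transfer_right_sparse:
  assumes "right_sparse r (E k) b h" "0 < h"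
  shows "amount (E (Suc k)) (b - h) b \<le> \<tau> * h"
proof (rule transfer[OF assms(2)])
  have "amount (E k) b (b + h) \<le> r * h"
    using assms by (auto simp: right_sparse_def dest: spec[of _ "b + h"])
  also have "\<dots> < \<rho> * h" using params assms(2) by simp
  finally show "amount (E k) b (b + h) < \<rho> * h" .
qed

text \<open>
  The induction passes from $b$ to the right endpoints $v$ of the rising sun intervals of
  $E_{j+1}$ and gains the factor $\tau/r$ because these intervals have total length at most
  $|E_{j+1} \cap (b-h,b)| / r \le (\tau/r) h$.
\<close>

lemma decay:
  assumes "right_sparse r (E j) b h" "0 < h"
  shows "amount (E (j + k)) (b - h) b \<le> (\<tau> / r) ^ k * h"
  using assms
proof (induction k arbitrary: j b h)
  case 0
  then show ?case using amount_le_length[OF meas, of "b - h" b] by simp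
next
  case (Suc k)
  let ?F = "E (Suc j + k)" and ?q = "(\<tau> / r) ^ k"
  have q: "0 \<le> ?q" using params by simp
  have "right_sparse r (E (Suc j)) b h"
    by (rule right_sparse_mono[OF Suc.prems(1)]) (use decreasing meas in auto)
  then obtain V where V: "open V" "V \<subseteq> {b - h<..<b}"
      "measure lebesgue (E (Suc j) \<inter> {b - h<..<b} - V) = 0"
      "\<And>u v. u < v \<Longrightarrow> {u<..<v} \<subseteq> V \<Longrightarrow> u \<notin> V \<Longrightarrow> v \<notin> V \<Longrightarrow>
         right_sparse r (E (Suc j)) v (v - u) \<and> r * (v - u) \<le> amount (E (Suc j)) u v"
    by (rule rising_sun[OF meas, of r "Suc j" b h, rotated 2]) (use params in auto)
  have FE: "?F \<subseteq> E (Suc j)"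
    by (rule lift_Suc_antimono_le[of E]) (use decreasing in auto)
  have bV: "bounded V" using bounded_subset[OF _ V(2)] by simp
  \<comment> \<open>On a component, the induction hypothesis bounds the higher level by its length, and the density
    at least $r$ bounds its length by the lower level.\<close>
  have "measure lebesgue (?F \<inter> V) \<le> ?q / r * measure lebesgue (E (Suc j) \<inter> V)"
  proof (rule measure_le_by_components[OF V(1) bV meas meas])
    fix u v assume uv: "u < v" "{u<..<v} \<subseteq> V" "u \<notin> V" "v \<notin> V"
    have "amount ?F u v \<le> ?q * (v - u)"
      using Suc.IH[of "Suc j" v "v - u"] V(4)[OF uv] uv(1) by simp
    also have "\<dots> \<le> ?q * (amount (E (Suc j)) u v / r)"
      using V(4)[OF uv] params by (intro mult_left_mono q) (simp add: field_simps)
    finally show "measure lebesgue (?F \<inter> {u<..<v})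
        \<le> ?q / r * measure lebesgue (E (Suc j) \<inter> {u<..<v})"
      by (simp add: amount_def)
  qed (use q params in auto)
  also have "\<dots> \<le> ?q / r * (\<tau> * h)"
  proof (rule mult_left_mono)
    have "measure lebesgue (E (Suc j) \<inter> V) \<le> amount (E (Suc j)) (b - h) b"
      unfolding amount_def
      by (rule measure_mono_fmeasurable)
         (use V amount_lmeasurable[OF meas] meas in auto)
    also have "\<dots> \<le> \<tau> * h" using transfer_right_sparse Suc.prems by blast
    finally show "measure lebesgue (E (Suc j) \<inter> V) \<le> \<tau> * h" .
  qed (use q params in auto)
  finally have main: "measure lebesgue (?F \<inter> V) \<le> (\<tau> / r) ^ Suc k * h" by (simp add: mult_ac)
  have lm: "X \<inter> {b - h<..<b} - V \<in> lmeasurable" if "X \<in> sets lebesgue" for X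
    using amount_lmeasurable[OF that] V(1) by (intro fmeasurable_Diff) auto
  have "measure lebesgue (?F \<inter> {b - h<..<b} - V) \<le> measure lebesgue (E (Suc j) \<inter> {b - h<..<b} - V)"
    using FE lm[OF meas] by (intro measure_mono_fmeasurable) (auto simp: fmeasurableD)
  then have "measure lebesgue (?F \<inter> {b - h<..<b} - V) \<le> 0" using V(3) by simp
  moreover have "amount ?F (b - h) b
      = measure lebesgue (?F \<inter> V) + measure lebesgue (?F \<inter> {b - h<..<b} - V)"
  proof -
    have "?F \<inter> {b - h<..<b} = ?F \<inter> V \<union> (?F \<inter> {b - h<..<b} - V)" using V(2) by auto
    moreover have "?F \<inter> V \<in> lmeasurable"
      using bV V(1) meas by (intro bounded_set_imp_lmeasurable sets.Int) auto
    ultimately show ?thesis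
      unfolding amount_def using lm[OF meas] measure_Un_AE[of "?F \<inter> V" "?F \<inter> {b - h<..<b} - V" lebesgue]
      by auto
  qed
  ultimately show ?case using main by simp
qed

text \<open>
  Since $E_k$ has density at least $r$ before the last peak but only density $\tau$ overall, the peak
  occurs in the first $\tau/r$ of the interval.
\<close>

lemma sparse_point_in:
  assumes sparse: "amount (E k) (b - h) b \<le> \<tau> * h" and "0 < h"
  obtains b' where "b - h \<le> b'" "b' \<le> b - (1 - \<tau> / r) * h"
    "\<And>w. b' < w \<Longrightarrow> w \<le> b \<Longrightarrow> amount (E k) b' w \<le> r * (w - b')"
proof -
  obtain y where y: "b - h \<le> y" "y \<le> b" "r * (y - (b - h)) \<le> amount (E k) (b - h) y"
    "\<And>w. y < w \<Longrightarrow> w \<le> b \<Longrightarrow> amount (E k) y w \<le> r * (w - y)"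
    using last_peak[OF meas[of k], of "b - h" b r] \<open>0 < h\<close> by auto
  have "amount (E k) (b - h) y \<le> amount (E k) (b - h) b"
    by (rule amount_mono) (use meas y in auto)
  then have "r * (y - (b - h)) \<le> \<tau> * h" using y(3) sparse by linarith
  then have "y \<le> b - (1 - \<tau> / r) * h" using params by (simp add: field_simps)
  then show thesis using that y by blast
qed

text \<open>
  The scale does not deteriorate under the shift, because sparseness up to $b$ and sparseness
  from $b$ onwards combine. This is what makes the shift repeatable.
\<close>

lemma sparse_point_shift:
  assumes "right_sparse r (E k) b h" "0 < h"
  obtains b' where "b - h \<le> b'" "b' \<le> b - (1 - \<tau> / r) * h" "right_sparse r (E (Suc k)) b' h"
proof -
  obtain b' where b': "b - h \<le> b'" "b' \<le> b - (1 - \<tau> / r) * h"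
    "\<And>w. b' < w \<Longrightarrow> w \<le> b \<Longrightarrow> amount (E (Suc k)) b' w \<le> r * (w - b')"
    using sparse_point_in[OF transfer_right_sparse[OF assms] assms(2)] by blast
  have "0 \<le> (1 - \<tau> / r) * h" using params assms(2) by simp
  then have le: "b' \<le> b" using b'(2) by linarith
  have "right_sparse r (E (Suc k)) b h"
    by (rule right_sparse_mono[OF assms(1)]) (use decreasing meas in auto)
  then have "right_sparse r (E (Suc k)) b' (b + h - b')"
    using right_sparse_extend[OF meas b'(3)] le by blast
  then have "right_sparse r (E (Suc k)) b' h"
    by (rule right_sparse_mono) (use le meas in auto)
  then show thesis using that b' by blast
qed

text \<open>
  After $n$ shifts the intervals of length $h$ to the left of the successive sparse points overlap or
  touch, since each shift is by at most $h$, and they reach at least $n (1 - \tau/r) h$ further to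
  the left, since it is by at least $(1 - \tau/r) h$.
\<close>

lemma decay_far:
  assumes "right_sparse r (E j) b h" "0 < h"
  shows "amount (E (j + n + k)) (b - h - real n * ((1 - \<tau> / r) * h)) b \<le> (real n + 1) * ((\<tau> / r) ^ k * h)"
  using assms
proof (induction n arbitrary: j b)
  case 0
  then show ?case using decay[of j b h k] by simp
next
  case (Suc n)
  let ?d = "(1 - \<tau> / r) * h" and ?F = "E (j + Suc n + k)"
  obtain b' where b': "b - h \<le> b'" "b' \<le> b - ?d" "right_sparse r (E (Suc j)) b' h"
    using sparse_point_shift[OF Suc.prems] .
  have d: "0 \<le> ?d" using params Suc.prems(2) by simp
  have "0 \<le> real n * ?d" "real (Suc n) * ?d = real n * ?d + ?d"
    using mult_nonneg_nonneg[OF _ d, of "real n"] distrib_right[of "real n" 1 ?d]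
    by (simp_all only: of_nat_Suc of_nat_0_le_iff add.commute mult_1_left)
  with b'(2) d Suc.prems(2) have ends: "b' - h - real n * ?d \<le> b - h - real (Suc n) * ?d"
      "b' - h - real n * ?d \<le> b'" "b' \<le> b"
    by linarith+
  have "amount ?F (b - h - real (Suc n) * ?d) b \<le> amount ?F (b' - h - real n * ?d) b"
    by (rule amount_mono) (use meas ends in auto)
  also have "\<dots> = amount ?F (b' - h - real n * ?d) b' + amount ?F b' b"
    by (rule amount_split) (use meas ends in auto)
  also have "amount ?F (b' - h - real n * ?d) b' \<le> (real n + 1) * ((\<tau> / r) ^ k * h)"
    using Suc.IH[OF b'(3) Suc.prems(2)] by simp
  also have "amount ?F b' b \<le> amount (E (j + k)) (b - h) b"
    by (rule amount_mono[OF meas meas lift_Suc_antimono_le[of E]]) (use decreasing b'(1) in auto)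
  also have "\<dots> \<le> (\<tau> / r) ^ k * h" by (rule decay[OF Suc.prems])
  finally show ?case by (simp add: algebra_simps)
qed

text \<open>
  The intervals $(p-2L,p-L)$ and $(p-L,p)$ are the left and the middle third. With
  $\delta = 1 - \tau/r$, the middle third contains a sparse point at scale $\delta L$, and each
  shift then gains at least $\delta^2 L$. As the way to the left end is shorter than $2L$, the
  condition on $n$ guarantees that $n$ shifts suffice.
\<close>

lemma decay_across_gap:
  assumes sparse: "amount (E 0) (p - L) p \<le> \<tau> * L" and "0 < L"
    and n: "2 \<le> real n * (1 - \<tau> / r)\<^sup>2"
  shows "amount (E (n + k)) (p - 2 * L) (p - L) \<le> (real n + 1) * (\<tau> / r) ^ k * L"
proof -
  define \<delta> where "\<delta> = 1 - \<tau> / r"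
  have \<delta>: "0 < \<delta>" "\<delta> \<le> 1" using params by (auto simp: \<delta>_def)
  obtain b where b: "p - L \<le> b" "b \<le> p - \<delta> * L"
    "\<And>w. b < w \<Longrightarrow> w \<le> p \<Longrightarrow> amount (E 0) b w \<le> r * (w - b)"
    using sparse_point_in[OF sparse \<open>0 < L\<close>] by (metis \<delta>_def)
  have "right_sparse r (E 0) b (\<delta> * L)"
    using b(2,3) by (simp add: right_sparse_def)
  then have "amount (E (n + k)) (b - \<delta> * L - real n * (\<delta> * (\<delta> * L))) b
      \<le> (real n + 1) * ((\<tau> / r) ^ k * (\<delta> * L))"
    using decay_far[of 0 b "\<delta> * L" n k] \<delta>(1) \<open>0 < L\<close> by (simp add: \<delta>_def)
  moreover have "amount (E (n + k)) (p - 2 * L) (p - L)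
      \<le> amount (E (n + k)) (b - \<delta> * L - real n * (\<delta> * (\<delta> * L))) b"
  proof (rule amount_mono)
    have "2 * L \<le> real n * (\<delta> * \<delta>) * L"
      using n \<open>0 < L\<close> by (intro mult_right_mono) (auto simp: \<delta>_def power2_eq_square)
    then have "2 * L \<le> real n * (\<delta> * (\<delta> * L))" by (simp add: mult.assoc)
    moreover have "0 \<le> \<delta> * L" using \<delta>(1) \<open>0 < L\<close> by simp
    ultimately show "b - \<delta> * L - real n * (\<delta> * (\<delta> * L)) \<le> p - 2 * L"
      using b(2) by linarith
  qed (use meas b in auto)
  moreover have "(\<tau> / r) ^ k * (\<delta> * L) \<le> (\<tau> / r) ^ k * (1 * L)"
  proof (rule mult_left_mono)
    show "\<delta> * L \<le> 1 * L" using \<delta> \<open>0 < L\<close> by (intro mult_right_mono) auto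
    show "0 \<le> (\<tau> / r) ^ k" using params by simp
  qed
  then have "(real n + 1) * ((\<tau> / r) ^ k * (\<delta> * L))
      \<le> (real n + 1) * ((\<tau> / r) ^ k * (1 * L))"
    by (rule mult_left_mono) simp
  ultimately have "amount (E (n + k)) (p - 2 * L) (p - L) \<le> (real n + 1) * ((\<tau> / r) ^ k * (1 * L))"
    by linarith
  then show ?thesis by (simp add: mult.assoc)
qed

end

section \<open>Maximal medians and superlevel sets\<close>

lemma sets_lebesgue_level:
  fixes f :: "real \<Rightarrow> real"
  assumes "f \<in> borel_measurable lebesgue"
  shows "{x. f x < l} \<in> sets lebesgue" "{x. f x \<le> l} \<in> sets lebesgue" "{x. l < f x} \<in> sets lebesgue"
proof -
  note [measurable] = assms
  have "{x \<in> space lebesgue. f x < l} \<in> sets lebesgue" by measurable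
  moreover have "{x \<in> space lebesgue. f x \<le> l} \<in> sets lebesgue" by measurable
  moreover have "{x \<in> space lebesgue. l < f x} \<in> sets lebesgue" by measurable
  ultimately show "{x. f x < l} \<in> sets lebesgue" "{x. f x \<le> l} \<in> sets lebesgue"
      "{x. l < f x} \<in> sets lebesgue" by simp_all
qed

lemma max_median_interval:
  "max_median s f {c<..<d} = Sup {l. amount {x. f x < l} c d \<le> s * measure lebesgue {c<..<d}}"
proof -
  have "{x \<in> {c<..<d}. f x < l} = {x. f x < l} \<inter> {c<..<d}" for l by auto
  then show ?thesis by (simp add: max_median_def amount_def)
qed

text \<open>
  The set of admissible levels is nonempty because $s > 0$ and the sets $\{f < -n\}$ shrink to the empty set;
  without this the supremum would be an arbitrary value.
\<close>

lemma max_median_le: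
  fixes f :: "real \<Rightarrow> real"
  assumes f: "f \<in> borel_measurable lebesgue" and "0 < s" "c < d"
    and big: "s * (d - c) < amount {x. f x \<le> m} c d"
  shows "max_median s f {c<..<d} \<le> m"
proof -
  let ?A = "\<lambda>n::nat. {x. f x < - real n} \<inter> {c<..<d}"
  have "(\<lambda>n. measure lebesgue (?A n)) \<longlonglongrightarrow> measure lebesgue (\<Inter>n. ?A n)"
  proof (rule Lim_measure_decseq)
    show "range ?A \<subseteq> sets lebesgue"
      using sets_lebesgue_level[OF f] by auto
    show "decseq ?A" by (force simp: decseq_def)
    show "emeasure lebesgue (?A i) \<noteq> \<infinity>" for i
      using fmeasurableD2[OF amount_lmeasurable[OF sets_lebesgue_level(1)[OF f]]]
      by (simp only: infinity_ennreal_def not_False_eq_True)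
  qed
  moreover have "(\<Inter>n. ?A n) = {}"
  proof -
    have "\<exists>n. \<not> f x < - real n" for x
      using reals_Archimedean2[of "- f x"] by (metis less_minus_iff less_asym)
    then show ?thesis by blast
  qed
  moreover have "0 < s * (d - c)" using assms by simp
  ultimately have "eventually (\<lambda>n. measure lebesgue (?A n) < s * (d - c)) sequentially"
    by (auto intro: order_tendstoD)
  then obtain n where n: "measure lebesgue (?A n) < s * (d - c)"
    by (auto simp: eventually_sequentially)
  show ?thesis
    unfolding max_median_interval
  proof (rule cSup_least)
    show "{l. amount {x. f x < l} c d \<le> s * measure lebesgue {c<..<d}} \<noteq> {}"
      using n \<open>c < d\<close> by (auto simp: amount_def intro!: exI[of _ "- real n"])
    fix l assume "l \<in> {l. amount {x. f x < l} c d \<le> s * measure lebesgue {c<..<d}}"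
    then have l: "amount {x. f x < l} c d \<le> s * (d - c)" using \<open>c < d\<close> by simp
    show "l \<le> m"
    proof (rule ccontr)
      assume "\<not> l \<le> m"
      then have "amount {x. f x \<le> m} c d \<le> amount {x. f x < l} c d"
        using sets_lebesgue_level[OF f] by (intro amount_mono) auto
      then show False using l big by linarith
    qed
  qed
qed

text \<open>
  Similarly, the set of admissible levels is bounded above because the sets $\{f < n\}$ exhaust
  the interval and $s < 1$.
\<close>

lemma max_median_lessD:
  fixes f :: "real \<Rightarrow> real"
  assumes f: "f \<in> borel_measurable lebesgue" and "s < 1" "c < d"
    and less: "max_median s f {c<..<d} < m"
  shows "s * (d - c) < amount {x. f x < m} c d"
proof (rule ccontr)
  assume not: "\<not> s * (d - c) < amount {x. f x < m} c d"
  let ?A = "\<lambda>n::nat. {x. f x < real n} \<inter> {c<..<d}"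
  have "(\<lambda>n. measure lebesgue (?A n)) \<longlonglongrightarrow> measure lebesgue (\<Union>n. ?A n)"
  proof (rule Lim_measure_incseq)
    show "range ?A \<subseteq> sets lebesgue"
      using sets_lebesgue_level[OF f] by auto
    show "incseq ?A" by (force simp: incseq_def)
    have "emeasure lebesgue (\<Union>i. ?A i) \<le> emeasure lebesgue {c<..<d}"
      by (rule emeasure_mono) auto
    also have "\<dots> < \<infinity>" using \<open>c < d\<close> by simp
    finally show "emeasure lebesgue (\<Union>i. ?A i) \<noteq> \<infinity>" by simp
  qed
  moreover have "(\<Union>n. ?A n) = {c<..<d}" using reals_Archimedean2 by auto
  moreover have "s * (d - c) < d - c" using assms by simp
  ultimately have "eventually (\<lambda>n. s * (d - c) < measure lebesgue (?A n)) sequentially"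
    using \<open>c < d\<close> by (auto intro: order_tendstoD)
  then obtain n where n: "s * (d - c) < amount {x. f x < real n} c d"
    by (auto simp: eventually_sequentially amount_def)
  have "m \<le> max_median s f {c<..<d}"
    unfolding max_median_interval
  proof (rule cSup_upper)
    show "m \<in> {l. amount {x. f x < l} c d \<le> s * measure lebesgue {c<..<d}}"
      using not \<open>c < d\<close> by simp
    show "bdd_above {l. amount {x. f x < l} c d \<le> s * measure lebesgue {c<..<d}}"
    proof (rule bdd_aboveI[of _ "real n"], rule ccontr)
      fix l assume "l \<in> {l. amount {x. f x < l} c d \<le> s * measure lebesgue {c<..<d}}"
      then have l: "amount {x. f x < l} c d \<le> s * (d - c)" using \<open>c < d\<close> by simp
      assume "\<not> l \<le> real n"
      then have "amount {x. f x < real n} c d \<le> amount {x. f x < l} c d"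
        using sets_lebesgue_level[OF f] by (intro amount_mono) auto
      then show False using l n by linarith
    qed
  qed
  then show False using less by linarith
qed

lemma amount_complement:
  fixes f :: "real \<Rightarrow> real"
  assumes "f \<in> borel_measurable lebesgue" "c < d"
  shows "amount {x. f x \<le> m} c d + amount {x. m < f x} c d = d - c"
proof -
  have "measure lebesgue ({x. f x \<le> m} \<inter> {c<..<d} \<union> {x. m < f x} \<inter> {c<..<d})
      = amount {x. f x \<le> m} c d + amount {x. m < f x} c d"
    unfolding amount_def using sets_lebesgue_level[OF assms(1)]
    by (intro measure_Un_AE amount_lmeasurable) auto
  moreover have "{x. f x \<le> m} \<inter> {c<..<d} \<union> {x. m < f x} \<inter> {c<..<d} = {c<..<d}" by auto
  ultimately show ?thesis using assms(2) by simp
qed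

lemma amount_superlevel:
  fixes f :: "real \<Rightarrow> real"
  assumes f: "f \<in> borel_measurable lebesgue" and "s < 1" "c < d"
    and "max_median s f {c<..<d} < m"
  shows "amount {x. m < f x} c d < (1 - s) * (d - c)"
proof -
  have "s * (d - c) < amount {x. f x < m} c d" by (rule max_median_lessD) fact+
  also have "\<dots> \<le> amount {x. f x \<le> m} c d"
    using sets_lebesgue_level[OF f] by (intro amount_mono) auto
  finally show ?thesis using amount_complement[OF f \<open>c < d\<close>, of m] by (simp add: algebra_simps)
qed

text \<open>
  The strict inequality $s < \sigma$ turns the assumed sparseness of $\{f > m\}$ into a bound for
  $M_s$ on the right interval. Replacing $C$ by $2C$ makes the bound for $M_t$ on the left interval
  strict; only a strict bound on a supremum excludes the level from its defining set and so becomes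
  a measure estimate.
\<close>

lemma median_transfer:
  fixes f :: "real \<Rightarrow> real"
  assumes f: "f \<in> borel_measurable lebesgue" and "0 < s" "s < \<sigma>" "t < 1" "0 < C" "0 < h"
    and hyp: "\<And>a b. a < b \<Longrightarrow> max_median t f (left_half a b) - max_median s f (right_half a b) \<le> C"
    and sparse: "amount {x. m < f x} b (b + h) < (1 - \<sigma>) * h"
  shows "amount {x. m + 2 * C < f x} (b - h) b \<le> (1 - t) * h"
proof -
  have "s * h < \<sigma> * h" using assms by simp
  moreover have "amount {x. f x \<le> m} b (b + h) + amount {x. m < f x} b (b + h) = h"
    using amount_complement[OF f, of b "b + h" m] \<open>0 < h\<close> by simp
  moreover have "(1 - \<sigma>) * h = h - \<sigma> * h" by (simp add: algebra_simps)
  ultimately have "s * h < amount {x. f x \<le> m} b (b + h)" using sparse by linarith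
  then have "max_median s f {b<..<b + h} \<le> m"
    using \<open>0 < s\<close> \<open>0 < h\<close> by (intro max_median_le f) auto
  moreover have "max_median t f {b - h<..<b} - max_median s f {b<..<b + h} \<le> C"
    using hyp[of "b - h" "b + h"] \<open>0 < h\<close> by (simp add: left_half_def right_half_def)
  ultimately have "max_median t f {b - h<..<b} < m + 2 * C" using \<open>0 < C\<close> by linarith
  from amount_superlevel[OF f \<open>t < 1\<close> _ this] show ?thesis using \<open>0 < h\<close> by simp
qed

section \<open>The exponential estimate\<close>

text \<open>
  The base $\theta = \tau/r$ and the number $n$ of shifts depend on $\sigma$ and $t$ only. With
  $q = \lambda/(2C)$ the target is the bound $(n+1)\, \theta^{q-(n+3)}$ for the fraction of the left
  third: for $q < n + 2$ it exceeds $1$, and for larger $q$ the level $E_{n+k}$ applies with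
  $k = \lfloor q \rfloor - (n+2)$.
\<close>

theorem theorem3p4:
  fixes \<sigma> t :: real
  assumes "0 < \<sigma>" and "\<sigma> < t" and "t < 1"
  shows "\<exists>K>0. \<exists>\<alpha>>0. \<forall>(f :: real \<Rightarrow> real) (s :: real) (C :: real).
           f \<in> borel_measurable lebesgue \<longrightarrow> 0 < s \<longrightarrow> s < \<sigma> \<longrightarrow> C > 0 \<longrightarrow>
           (\<forall>a b. a < b \<longrightarrow>
              max_median t f (left_half a b) - max_median s f (right_half a b) \<le> C) \<longrightarrow>
           (\<forall>a b lam. a < b \<longrightarrow> lam > 0 \<longrightarrow>
              measure lebesgue
                {x \<in> left_third a b. f x - max_median \<sigma> f (right_third a b) > lam}
              \<le> K * measure lebesgue (left_third a b) * exp (- \<alpha> * lam / C))"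
proof -
  define r where "r = (1 - t + (1 - \<sigma>)) / 2"
  define \<theta> where "\<theta> = (1 - t) / r"
  have r: "1 - t < r" "r < 1 - \<sigma>" using assms by (auto simp: r_def field_simps)
  have \<theta>: "0 < \<theta>" "\<theta> < 1" using r assms by (auto simp: \<theta>_def)
  obtain n where n: "2 \<le> real n * (1 - \<theta>)\<^sup>2"
  proof -
    obtain n where "2 / (1 - \<theta>)\<^sup>2 < real n" using reals_Archimedean2 by blast
    then have "2 \<le> real n * (1 - \<theta>)\<^sup>2" using \<theta> by (simp add: field_simps)
    then show thesis by (rule that)
  qed
  define K where "K = (real n + 1) * \<theta> powr - (real n + 3)"
  define \<alpha> where "\<alpha> = - ln \<theta> / 2"
  have K: "0 < K" using \<theta> by (simp add: K_def)
  have \<alpha>: "0 < \<alpha>" using \<theta> by (simp add: \<alpha>_def)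
  show ?thesis
  proof (rule exI[of _ K], rule conjI[OF K], rule exI[of _ \<alpha>], rule conjI[OF \<alpha>], intro allI impI)
    fix f :: "real \<Rightarrow> real" and s C a b lam :: real
    assume f: "f \<in> borel_measurable lebesgue" and s: "0 < s" "s < \<sigma>" and C: "C > 0"
      and hyp: "\<forall>a b. a < b \<longrightarrow>
              max_median t f (left_half a b) - max_median s f (right_half a b) \<le> C"
      and ab: "a < b" and lam: "lam > 0"
    define L p M where "L = (b - a) / 3" and "p = (a + 2 * b) / 3"
      and "M = max_median \<sigma> f (right_third a b)"
    have L: "0 < L" using ab by (simp add: L_def)
    have right: "right_third a b = {p<..<p + L}" and left: "left_third a b = {p - 2 * L<..<p - L}"
      by (auto simp: right_third_def left_third_def p_def L_def field_simps)
    \<comment> \<open>The levels start at $M + 3C$: one $C$ makes the superlevel set strictly sparse in the right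
      third, and the transfer to the middle third costs $2C$.\<close>
    define E where "E = (\<lambda>k::nat. {x. M + 3 * C + real k * (2 * C) < f x})"
    have shift: "amount {x. m + 2 * C < f x} (y - h) y \<le> (1 - t) * h"
      if "0 < h" "amount {x. m < f x} y (y + h) < (1 - \<sigma>) * h" for m y h
      by (rule median_transfer[OF f s assms(3) C that(1) _ that(2)]) (use hyp in blast)
    interpret one_sided_levels E "1 - \<sigma>" r "1 - t"
    proof
      show "E k \<in> sets lebesgue" for k unfolding E_def by (rule sets_lebesgue_level(3)[OF f])
      show "E (Suc k) \<subseteq> E k" for k using C by (auto simp: E_def algebra_simps)
      show "0 < 1 - t" "1 - t < r" "r < 1 - \<sigma>" "1 - \<sigma> < 1" using assms r by auto
      show "amount (E (Suc k)) (b - h) b \<le> (1 - t) * h"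
        if "0 < h" "amount (E k) b (b + h) < (1 - \<sigma>) * h" for h b k
        using shift[OF that(1) that(2)[unfolded E_def]] by (simp add: E_def algebra_simps)
    qed
    have "amount {x. M + C < f x} p (p + L) < (1 - \<sigma>) * L"
      using amount_superlevel[OF f, of \<sigma> p "p + L" "M + C"] assms L C by (simp add: M_def right)
    from shift[OF L this] have "amount (E 0) (p - L) p \<le> (1 - t) * L"
      by (simp add: E_def algebra_simps)
    then have decay: "amount (E (n + k)) (p - 2 * L) (p - L) \<le> (real n + 1) * \<theta> ^ k * L" for k
      using decay_across_gap[of p L n k] L n by (simp add: \<theta>_def)
    define q where "q = lam / (2 * C)"
    have q: "0 < q" using lam C by (simp add: q_def)
    have expq: "exp (- \<alpha> * lam / C) = \<theta> powr q"
      using \<theta> by (simp add: \<alpha>_def q_def powr_def)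
    define S where "S = {x. M + lam < f x}"
    have S: "S \<in> sets lebesgue" unfolding S_def by (rule sets_lebesgue_level(3)[OF f])
    have "amount S (p - 2 * L) (p - L) \<le> (real n + 1) * \<theta> powr (q - (real n + 3)) * L"
    proof (cases "q < real n + 2")
      case True
      have "amount S (p - 2 * L) (p - L) \<le> 1 * L"
        using amount_le_length[OF S, of "p - 2 * L" "p - L"] L by simp
      also have "\<theta> powr 0 \<le> \<theta> powr (q - (real n + 3))"
        using True \<theta> by (intro powr_mono') auto
      then have "1 * L \<le> \<theta> powr (q - (real n + 3)) * L" using \<theta> L by simp
      also have "\<dots> \<le> (real n + 1) * (\<theta> powr (q - (real n + 3)) * L)"
        using L by (simp add: mult_le_cancel_right1 distrib_right)
      finally show ?thesis by (simp add: mult.assoc)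
    next
      case False
      define k where "k = nat \<lfloor>q\<rfloor> - (n + 2)"
      have "real (nat \<lfloor>q\<rfloor>) = of_int \<lfloor>q\<rfloor>" using q by simp
      then have "real (nat \<lfloor>q\<rfloor>) \<le> q" "q < real (nat \<lfloor>q\<rfloor>) + 1" by linarith+
      moreover have "n + 2 \<le> nat \<lfloor>q\<rfloor>" using False q by (simp add: le_nat_iff le_floor_iff)
      moreover from this have "real k = real (nat \<lfloor>q\<rfloor>) - (real n + 2)"
        by (simp add: k_def of_nat_diff)
      ultimately have k: "real n + 2 + real k \<le> q" "q - (real n + 3) \<le> real k"
        by linarith+
      have "(real n + 2 + real k) * (2 * C) \<le> q * (2 * C)"
        using k C by (intro mult_right_mono) auto
      then have "3 * C + real (n + k) * (2 * C) \<le> lam"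
        using C by (simp add: q_def algebra_simps)
      then have "S \<subseteq> E (n + k)" by (auto simp: S_def E_def)
      then have "amount S (p - 2 * L) (p - L) \<le> amount (E (n + k)) (p - 2 * L) (p - L)"
        using S meas by (intro amount_mono) auto
      also have "\<dots> \<le> (real n + 1) * \<theta> ^ k * L" by (rule decay)
      also have "\<theta> ^ k = \<theta> powr real k" using \<theta> by (simp add: powr_realpow)
      also have "\<dots> \<le> \<theta> powr (q - (real n + 3))"
        using k \<theta> by (intro powr_mono') auto
      then have "(real n + 1) * \<theta> powr real k * L \<le> (real n + 1) * \<theta> powr (q - (real n + 3)) * L"
        using L by (intro mult_right_mono mult_left_mono) auto
      finally show ?thesis .
    qed
    also have "\<theta> powr (q - (real n + 3)) = \<theta> powr - (real n + 3) * \<theta> powr q"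
      by (simp add: algebra_simps flip: powr_add)
    finally have "amount S (p - 2 * L) (p - L) \<le> K * L * \<theta> powr q"
      by (simp add: K_def mult_ac)
    moreover have "{x \<in> left_third a b. f x - M > lam} = S \<inter> {p - 2 * L<..<p - L}"
      by (auto simp: left S_def)
    moreover have "measure lebesgue (left_third a b) = L" using L by (simp add: left)
    ultimately show "measure lebesgue
          {x \<in> left_third a b. f x - max_median \<sigma> f (right_third a b) > lam}
        \<le> K * measure lebesgue (left_third a b) * exp (- \<alpha> * lam / C)"
      unfolding expq M_def[symmetric] by (simp add: amount_def)
  qed
qed

end
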